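(* Let $\Gamma=G(\mathbb{Z}_n,\mathcal{C})$ be a connected oriented circulant graph with $n\equiv 0\pmod 4$. There is zero transfer between the vertices $n/4$ and $0$ if and only if, for every eigenvalue $\theta_i$ of $\Gamma$ with index set $M_{\theta_i}$, $$|M_{\theta_i}\cap(4\mathbb{Z})|=|M_{\theta_i}\cap(4\mathbb{Z}+2)|\quad\text{and}\quad |M_{\theta_i}\cap(4\mathbb{Z}+1)|=|M_{\theta_i}\cap(4\mathbb{Z}+3)|.$$
   Context: For $\mathcal{C}\subseteq\mathbb{Z}_n\setminus\{0\}$, the circulant graph $G(\mathbb{Z}_n,\mathcal{C})$ has vertex set $\mathbb{Z}_n$ and arc set $\{(a,b): b-a\in\mathcal{C},\ a,b\in\mathbb{Z}_n\}$; it is an oriented circulant graph if $\mathcal{C}\cap\mathcal{C}^{-1}=\emptyset$, where $\mathcal{C}^{-1}=\{-c: c\in\mathcal{C}\}$. Connected means that the underlying undirected graph is connected. Its Hermitian adjacency matrix $H$ has $H_{a,b}=\mathrm{i}$ if $b-a\in\mathcal{C}$, $H_{a,b}=-\mathrm{i}$ if $a-b\in\mathcal{C}$, and $H_{a,b}=0$ otherwise, where $\mathrm{i}=\sqrt{-1}$; the eigenvalues of $\Gamma$ are those of $H$. With $\omega_n=\exp(2\pi\mathrm{i}/n)$, the eigenvalues of $H$, listed with multiplicity, are $\mu_j=\mathrm{i}\sum_{k\in\mathcal{C}}(\omega_n^{jk}-\omega_n^{-jk})=-2\sum_{k\in\mathcal{C}}\sin(2\pi jk/n)$ for $j=0,1,\ldots,n-1$,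 with eigenvectors $(1,\omega_n^j,\ldots,\omega_n^{(n-1)j})^\top$. For an eigenvalue $\theta$, the index set is $M_\theta=\{j\in\mathbb{Z}_n:\mu_j=\theta\}$; since $4\mid n$, residues modulo $4$ of elements of $\mathbb{Z}_n$ are well defined, and $M_\theta\cap(4\mathbb{Z}+c)$ is the set of elements of $M_\theta$ congruent to $c$ modulo $4$. The transition matrix is $U(t)=\exp(-\mathrm{i}tH)$, $t\in\mathbb{R}$. There is zero transfer between vertices $u$ and $v$ if $U(t)_{u,v}=0$ for all $t\ge 0$ (this condition is symmetric in $u$ and $v$). *)

theory Defs
  imports
    Complex_Main
    "Jordan_Normal_Form.Char_Poly"
    "Graph_Theory.Digraph_Component"
begin

text \<open>
  \<open>\<int>\<^sub>n\<close> is represented by its least nonnegative residues. A connection set is a set of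
  integers in \<open>{0..<n}\<close>; vertices are natural numbers in \<open>{0..<n}\<close>, so that they
  also index the rows and columns of matrices. Differences are reduced modulo \<open>n\<close>.
\<close>

definition zn_diff :: "nat \<Rightarrow> nat \<Rightarrow> nat \<Rightarrow> int" where
  "zn_diff n b a = (int b - int a) mod int n"

definition connection_set :: "nat \<Rightarrow> int set \<Rightarrow> bool" where
  "connection_set n C \<longleftrightarrow> C \<subseteq> {0..<int n} - {0}"

definition zn_inverse :: "nat \<Rightarrow> int set \<Rightarrow> int set" where
  "zn_inverse n C = (\<lambda>c. (- c) mod int n) ` C"

definition circulant_graph :: "nat \<Rightarrow> int set \<Rightarrow> nat pair_pre_digraph" where
  "circulant_graph n C =
     \<lparr> pverts = {0..<n}, parcs = {(a, b). a < n \<and> b < n \<and> zn_diff n b a \<in> C} \<rparr>"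

definition oriented_circulant :: "nat \<Rightarrow> int set \<Rightarrow> bool" where
  "oriented_circulant n C \<longleftrightarrow> connection_set n C \<and> C \<inter> zn_inverse n C = {}"

text \<open>
  The constant \<open>Digraph_Component.connected\<close> is connectedness of the underlying
  undirected graph (the topological notion has the same base name).
\<close>

definition connected_circulant :: "nat \<Rightarrow> int set \<Rightarrow> bool" where
  "connected_circulant n C \<longleftrightarrow>
     Digraph_Component.connected (with_proj (circulant_graph n C))"

definition herm_adj :: "nat \<Rightarrow> int set \<Rightarrow> complex mat" where
  "herm_adj n C = mat n n (\<lambda>(a, b).
     if zn_diff n b a \<in> C then \<i>
     else if zn_diff n a b \<in> C then - \<i>
     else 0)"

definition omega :: "nat \<Rightarrow> complex" where
  "omega n = exp (2 * of_real pi * \<i> / of_nat n)"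

definition mu :: "nat \<Rightarrow> int set \<Rightarrow> nat \<Rightarrow> complex" where
  "mu n C j = \<i> * (\<Sum>k\<in>C. omega n powi (int j * k) - omega n powi (- (int j * k)))"

definition index_set :: "nat \<Rightarrow> int set \<Rightarrow> complex \<Rightarrow> nat set" where
  "index_set n C \<theta> = {j \<in> {0..<n}. mu n C j = \<theta>}"

text \<open>
  The exponential series of a square matrix. Convergence in \<open>\<complex>\<close>-matrices of fixed
  finite size is entrywise, and the series always converges.
\<close>

definition mat_exp :: "complex mat \<Rightarrow> complex mat" where
  "mat_exp A = mat (dim_row A) (dim_row A)
     (\<lambda>(a, b). \<Sum>k. (A ^\<^sub>m k) $$ (a, b) / fact k)"

definition transition_mat :: "nat \<Rightarrow> int set \<Rightarrow> real \<Rightarrow> complex mat" where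
  "transition_mat n C t = mat_exp ((- \<i> * of_real t) \<cdot>\<^sub>m herm_adj n C)"

definition zero_transfer :: "nat \<Rightarrow> int set \<Rightarrow> nat \<Rightarrow> nat \<Rightarrow> bool" where
  "zero_transfer n C u v \<longleftrightarrow> (\<forall>t::real. t \<ge> 0 \<longrightarrow> transition_mat n C t $$ (u, v) = 0)"

end

theory Submission
  imports Defs "HOL-Analysis.Complex_Transcendental"
begin

text \<open>
  The characters \<open>b \<mapsto> \<omega>\<^sup>j\<^sup>b\<close> diagonalise \<open>H\<close>, so
  \<open>U(t)\<^sub>u\<^sub>v = (\<Sum>j<n. exp (-\<i> t \<mu>\<^sub>j) \<omega>\<^sup>j\<^sup>(\<^sup>u\<^sup>-\<^sup>v\<^sup>)) / n\<close>.
  Exponentials with distinct frequencies are linearly independent on \<open>t \<ge> 0\<close>, so this vanishes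
  identically iff \<open>(\<Sum>j\<in>M\<^sub>\<theta>. \<omega>\<^sup>j\<^sup>(\<^sup>u\<^sup>-\<^sup>v\<^sup>)) = 0\<close> for every \<open>\<theta>\<close>. For
  \<open>u = n/4\<close>, \<open>v = 0\<close> the summands are the powers \<open>\<i>\<^sup>j\<close>, and the real and imaginary
  parts of the sum are the two differences of cardinalities.
\<close>

section \<open>Powers of the primitive root of unity\<close>

lemma omega_nonzero [simp]: "omega n \<noteq> 0"
  by (simp add: omega_def)

lemma omega_power: "omega n ^ k = cis (2 * pi * real k / real n)"
  unfolding omega_def cis_conv_exp
  by (simp add: exp_of_nat_mult [symmetric] algebra_simps)

lemma omega_power_self [simp]: "n > 0 \<Longrightarrow> omega n ^ n = 1"
  by (simp add: omega_power cis_multiple_2pi)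

lemma omega_powi_mult_mod:
  assumes "n > 0"
  shows "omega n powi (j * (x mod int n)) = omega n powi (j * x)"
proof -
  have "omega n powi (j * x) = omega n powi (j * (x mod int n) + int n * (j * (x div int n)))"
    by (rule arg_cong [where f = "power_int (omega n)"])
       (metis mult_div_mod_eq add.commute distrib_left mult.left_commute)
  also have "\<dots> = omega n powi (j * (x mod int n)) * (omega n powi int n) powi (j * (x div int n))"
    by (simp add: power_int_add power_int_mult)
  finally show ?thesis
    using assms by simp
qed

lemma omega_powi_diff_eq_1_iff:
  assumes "a < n" "b < n"
  shows "omega n powi (int a - int b) = 1 \<longleftrightarrow> a = b"
proof -
  have "inj_on (\<lambda>k. cis (2 * pi * real k / real n)) {..<n}"
    using Complex.bij_betw_roots_unity [of n] assms by (auto simp: bij_betw_def)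
  then have "omega n ^ a = omega n ^ b \<longleftrightarrow> a = b"
    using assms by (auto simp: omega_power inj_on_def)
  then show ?thesis
    by (simp add: power_int_diff)
qed

text \<open>A geometric sum whose ratio is an \<open>n\<close>-th root of unity, equal to
  \<open>1\<close> only on the diagonal.\<close>

lemma omega_orthogonality:
  assumes "a < n" "b < n"
  shows "(\<Sum>j<n. omega n powi (int j * (int a - int b))) = (if a = b then of_nat n else 0)"
proof -
  let ?z = "omega n powi (int a - int b)"
  have "n > 0" using assms by simp
  have *: "omega n powi (int j * (int a - int b)) = ?z ^ j" for j
    by (simp add: power_int_power' mult.commute)
  have "?z ^ n = (omega n ^ n) powi (int a - int b)"
    by (simp only: power_int_power' power_int_power mult.commute)
  then have "?z ^ n = 1"
    using \<open>n > 0\<close> by simp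
  then show ?thesis
    unfolding * using omega_powi_diff_eq_1_iff [OF assms]
    by (auto simp: geometric_sum)
qed

section \<open>Characters as eigenvectors of the Hermitian adjacency matrix\<close>

text \<open>For fixed \<open>a\<close>, the difference to \<open>a\<close> maps the neighbours in
  one direction bijectively onto \<open>C\<close>. This turns row sums of \<open>herm_adj\<close>
  against a character into sums over \<open>C\<close>.\<close>

lemma sum_translates:
  assumes "n > 0" "connection_set n C"
  shows "(\<Sum>b<n. if zn_diff n b a \<in> C then omega n powi (int j * int b) else 0) =
           (\<Sum>c\<in>C. omega n powi (int j * (int a + c)))" (is ?fwd)
    and "(\<Sum>b<n. if zn_diff n a b \<in> C then omega n powi (int j * int b) else 0) =
           (\<Sum>c\<in>C. omega n powi (int j * (int a - c)))" (is ?bwd)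
proof -
  have C: "0 \<le> c \<and> c < int n" if "c \<in> C" for c
    using assms(2) that by (auto simp: connection_set_def)
  have lt: "nat (x mod int n) < n" and [simp]: "0 \<le> x mod int n" for x
    using assms(1) by (auto simp: nat_less_iff)
  have "(\<Sum>b | b < n \<and> zn_diff n b a \<in> C. omega n powi (int j * int b)) =
          (\<Sum>c\<in>C. omega n powi (int j * (int a + c)))"
  proof (rule sum.reindex_bij_witness
      [where i = "\<lambda>c. nat ((int a + c) mod int n)" and j = "\<lambda>b. zn_diff n b a"])
    fix b assume "b \<in> {b. b < n \<and> zn_diff n b a \<in> C}"
    then show "nat ((int a + zn_diff n b a) mod int n) = b" "zn_diff n b a \<in> C"
      by (auto simp: zn_diff_def mod_add_right_eq)
    show "omega n powi (int j * (int a + zn_diff n b a)) = omega n powi (int j * int b)"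
      using assms(1)
      \<comment> \<open>Only the residue of the exponent factor matters, and modulo \<open>n\<close>
        adding the difference \<open>b - a\<close> to \<open>a\<close> gives back
        \<open>b\<close>.\<close>
      by (subst omega_powi_mult_mod [symmetric], simp)
         (simp add: zn_diff_def mod_add_right_eq omega_powi_mult_mod)
  next
    fix c assume "c \<in> C"
    then show "zn_diff n (nat ((int a + c) mod int n)) a = c"
      using C by (simp add: zn_diff_def mod_diff_left_eq)
    with \<open>c \<in> C\<close> show "nat ((int a + c) mod int n) \<in> {b. b < n \<and> zn_diff n b a \<in> C}"
      using lt by simp
  qed
  then show ?fwd
    by (simp add: sum.If_cases Collect_conj_eq lessThan_def)
  have "(\<Sum>b | b < n \<and> zn_diff n a b \<in> C. omega n powi (int j * int b)) =
          (\<Sum>c\<in>C. omega n powi (int j * (int a - c)))"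
  proof (rule sum.reindex_bij_witness
      [where i = "\<lambda>c. nat ((int a - c) mod int n)" and j = "\<lambda>b. zn_diff n a b"])
    fix b assume "b \<in> {b. b < n \<and> zn_diff n a b \<in> C}"
    then show "nat ((int a - zn_diff n a b) mod int n) = b" "zn_diff n a b \<in> C"
      by (auto simp: zn_diff_def mod_diff_right_eq)
    show "omega n powi (int j * (int a - zn_diff n a b)) = omega n powi (int j * int b)"
      using assms(1)
      by (subst omega_powi_mult_mod [symmetric], simp)
         (simp add: zn_diff_def mod_diff_right_eq omega_powi_mult_mod)
  next
    fix c assume "c \<in> C"
    then show "zn_diff n a (nat ((int a - c) mod int n)) = c"
      using C by (simp add: zn_diff_def mod_diff_right_eq)
    with \<open>c \<in> C\<close> show "nat ((int a - c) mod int n) \<in> {b. b < n \<and> zn_diff n a b \<in> C}"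
      using lt by simp
  qed
  then show ?bwd
    by (simp add: sum.If_cases Collect_conj_eq lessThan_def)
qed

text \<open>Orientation makes the two membership tests exclusive, so the nested conditional becomes
  a difference of indicators, over which row sums split.\<close>

lemma herm_adj_index:
  assumes "oriented_circulant n C" "a < n" "b < n"
  shows "herm_adj n C $$ (a, b) =
    \<i> * ((if zn_diff n b a \<in> C then 1 else 0) - (if zn_diff n a b \<in> C then 1 else 0))"
proof -
  have "zn_diff n a b = (- zn_diff n b a) mod int n"
    by (simp add: zn_diff_def mod_minus_eq)
  then have "\<not> (zn_diff n b a \<in> C \<and> zn_diff n a b \<in> C)"
    using assms(1) by (auto simp: oriented_circulant_def zn_inverse_def)
  then show ?thesis
    using assms by (auto simp: herm_adj_def)
qed

lemma herm_adj_carrier [simp]: "herm_adj n C \<in> carrier_mat n n"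
  by (simp add: herm_adj_def)

text \<open>Translating the argument of a character by \<open>c\<close> multiplies it by a factor
  independent of \<open>a\<close>; summed over \<open>C\<close> with signs, these factors give
  \<open>mu n C j\<close>.\<close>

lemma eigenvector_herm_adj:
  assumes "n > 0" "oriented_circulant n C"
  shows "eigenvector (herm_adj n C) (Matrix.vec n (\<lambda>b. omega n powi (int j * int b))) (mu n C j)"
proof -
  let ?H = "herm_adj n C" and ?w = "\<lambda>b::int. omega n powi (int j * b)"
  let ?v = "Matrix.vec n (\<lambda>b. ?w (int b))"
  have dims [simp]: "dim_row ?H = n" "dim_col ?H = n"
    by (simp_all add: herm_adj_def)
  have C: "connection_set n C"
    using assms(2) by (simp add: oriented_circulant_def)
  have "(?H *\<^sub>v ?v) $ a = mu n C j * ?w (int a)" if "a < n" for a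
  proof -
    have "(?H *\<^sub>v ?v) $ a = (\<Sum>b<n. ?H $$ (a, b) * ?w (int b))"
      using that by (simp add: scalar_prod_def atLeast0LessThan)
    also have "\<dots> = (\<Sum>b<n. \<i> * ((if zn_diff n b a \<in> C then ?w (int b) else 0) -
                       (if zn_diff n a b \<in> C then ?w (int b) else 0)))"
      using assms(2) that by (intro sum.cong) (auto simp: herm_adj_index)
    also have "\<dots> = \<i> * ((\<Sum>c\<in>C. ?w (int a + c)) - (\<Sum>c\<in>C. ?w (int a - c)))"
      by (simp add: sum_distrib_left [symmetric] sum_subtractf sum_translates [OF assms(1) C])
    also have "\<dots> = mu n C j * ?w (int a)"
    proof -
      have w: "?w (int a + c) = ?w (int a) * ?w c"
        "?w (int a - c) = ?w (int a) * omega n powi (- (int j * c))" for c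
        by (simp_all add: distrib_left right_diff_distrib flip: power_int_add)
      then show ?thesis
        unfolding w mu_def sum_subtractf sum_distrib_left [symmetric]
        by (simp add: algebra_simps)
    qed
    finally show ?thesis .
  qed
  then have "?H *\<^sub>v ?v = mu n C j \<cdot>\<^sub>v ?v"
    by (intro eq_vecI) auto
  moreover have "?v \<noteq> 0\<^sub>v n"
  proof
    assume "?v = 0\<^sub>v n"
    \<comment> \<open>The entry at \<open>0\<close> is a zeroth power, hence
      \<open>1\<close>.\<close>
    then have "?v $ 0 = 0\<^sub>v n $ 0" by simp
    with assms(1) show False by simp
  qed
  ultimately show ?thesis
    by (simp add: eigenvector_def)
qed

section \<open>Entries of matrix powers and of the transition matrix\<close>

text \<open>Expands the unit vector \<open>e\<^sub>v\<close> in the eigenvectors \<open>\<omega>\<^sup>j\<^sup>b\<close>, using orthogonality.\<close>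
lemma pow_mat_index_of_eigenvectors:
  assumes A: "A \<in> carrier_mat n n" and uv: "u < n" "v < n"
    and ev: "\<And>j. j < n \<Longrightarrow> eigenvector A (Matrix.vec n (\<lambda>b. omega n powi (int j * int b))) (l j)"
  shows "(A ^\<^sub>m k) $$ (u, v) =
    (\<Sum>j<n. l j ^ k * omega n powi (int j * (int u - int v))) / of_nat n"
proof -
  let ?w = "\<lambda>j b. omega n powi (int j * b)"
  have P: "A ^\<^sub>m k \<in> carrier_mat n n"
    using A by simp
  have row: "(\<Sum>b<n. (A ^\<^sub>m k) $$ (u, b) * ?w j (int b)) = l j ^ k * ?w j (int u)"
    if "j < n" for j
  proof -
    have "(A ^\<^sub>m k *\<^sub>v Matrix.vec n (\<lambda>b. ?w j (int b))) $ u = (l j ^ k \<cdot>\<^sub>v Matrix.vec n (\<lambda>b. ?w j (int b))) $ u"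
      using eigenvector_pow [OF A ev [OF that]] by simp
    then show ?thesis
      using uv A P by (simp add: scalar_prod_def atLeast0LessThan carrier_matD [OF A] carrier_matD [OF P])
  qed
  have split: "?w j (x - int v) = ?w j x * ?w j (- int v)" for j x
    by (simp add: right_diff_distrib flip: power_int_add)
  have "of_nat n * (A ^\<^sub>m k) $$ (u, v) =
      (\<Sum>b<n. (A ^\<^sub>m k) $$ (u, b) * (\<Sum>j<n. ?w j (int b - int v)))"
    using uv by (simp add: omega_orthogonality if_distrib [where f = "(*) _"] cong: if_cong)
  also have "\<dots> = (\<Sum>j<n. \<Sum>b<n. (A ^\<^sub>m k) $$ (u, b) * ?w j (int b) * ?w j (- int v))"
    unfolding split sum_distrib_left by (subst sum.swap) (simp add: mult.assoc)
  also have "\<dots> = (\<Sum>j<n. l j ^ k * ?w j (int u) * ?w j (- int v))"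
    by (intro sum.cong) (simp_all add: row flip: sum_distrib_right)
  also have "\<dots> = (\<Sum>j<n. l j ^ k * ?w j (int u - int v))"
    unfolding split by (simp add: mult.assoc)
  finally show ?thesis
    using uv by (simp add: field_simps)
qed

lemma eigenvector_smult:
  assumes "A \<in> carrier_mat n n" "eigenvector A v k"
  shows "eigenvector (c \<cdot>\<^sub>m A) v (c * k)"
proof -
  have "(c \<cdot>\<^sub>m A) *\<^sub>v v = c \<cdot>\<^sub>v (A *\<^sub>v v)"
  proof (rule eq_vecI)
    have dim: "dim_row A = n" "dim_col A = n" "dim_vec v = n"
      using assms by (auto simp: eigenvector_def)
    show "((c \<cdot>\<^sub>m A) *\<^sub>v v) $ i = (c \<cdot>\<^sub>v (A *\<^sub>v v)) $ i"
      if "i < dim_vec (c \<cdot>\<^sub>v (A *\<^sub>v v))" for i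
      using that by (simp add: dim scalar_prod_def sum_distrib_left mult.assoc)
  qed simp
  then show ?thesis
    using assms by (auto simp: eigenvector_def smult_smult_assoc)
qed

text \<open>The formula for powers is summed against the exponential series; the sum over
  \<open>j\<close> is finite, so it may be exchanged with the series.\<close>

lemma transition_mat_index:
  assumes "oriented_circulant n C" and uv: "u < n" "v < n"
  shows "transition_mat n C t $$ (u, v) =
    (\<Sum>j<n. exp (- \<i> * of_real t * mu n C j) * omega n powi (int j * (int u - int v))) / of_nat n"
proof -
  let ?c = "- \<i> * of_real t :: complex"
  let ?A = "?c \<cdot>\<^sub>m herm_adj n C" and ?l = "\<lambda>j. ?c * mu n C j"
  let ?w = "\<lambda>j. omega n powi (int j * (int u - int v))"
  have n: "n > 0" using uv by simp
  have A: "?A \<in> carrier_mat n n" by simp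
  have dim: "dim_row (herm_adj n C) = n" by (simp add: herm_adj_def)
  have ev: "eigenvector ?A (Matrix.vec n (\<lambda>b. omega n powi (int j * int b))) (?l j)" for j
    by (intro eigenvector_smult [OF herm_adj_carrier] eigenvector_herm_adj n assms(1))
  have "(\<lambda>k. \<Sum>j<n. ?l j ^ k /\<^sub>R fact k * ?w j) sums (\<Sum>j<n. exp (?l j) * ?w j)"
    by (intro sums_sum sums_mult2 exp_converges)
  then have "(\<lambda>k. (\<Sum>j<n. ?l j ^ k /\<^sub>R fact k * ?w j) / of_nat n) sums
      ((\<Sum>j<n. exp (?l j) * ?w j) / of_nat n)"
    by (rule sums_divide)
  moreover have "(?A ^\<^sub>m k) $$ (u, v) / fact k = (\<Sum>j<n. ?l j ^ k /\<^sub>R fact k * ?w j) / of_nat n" for k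
    unfolding pow_mat_index_of_eigenvectors [OF A uv ev]
    by (simp add: sum_divide_distrib scaleR_conv_of_real field_simps)
  ultimately have "(\<lambda>k. (?A ^\<^sub>m k) $$ (u, v) / fact k) sums ((\<Sum>j<n. exp (?l j) * ?w j) / of_nat n)"
    by simp
  then have "(\<Sum>k. (?A ^\<^sub>m k) $$ (u, v) / fact k) = (\<Sum>j<n. exp (?l j) * ?w j) / of_nat n"
    by (rule sums_unique [symmetric])
  then show ?thesis
    using uv by (simp add: transition_mat_def mat_exp_def dim)
qed

section \<open>Linear independence of exponentials\<close>

text \<open>A Vandermonde argument: by linearity the relation holds with any polynomial in place of
  the powers, and a Lagrange-type product isolates a single coefficient.\<close>

lemma geometric_sequences_independent:
  fixes z c :: "'a \<Rightarrow> 'b::idom"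
  assumes fin: "finite S" and inj: "inj_on z S"
    and vanish: "\<And>m::nat. (\<Sum>x\<in>S. c x * z x ^ m) = 0"
    and "x \<in> S"
  shows "c x = 0"
proof -
  have poly: "(\<Sum>y\<in>S. c y * poly p (z y)) = 0" for p
  proof -
    have "(\<Sum>y\<in>S. c y * poly p (z y)) =
        (\<Sum>i\<le>degree p. coeff p i * (\<Sum>y\<in>S. c y * z y ^ i))"
      unfolding poly_altdef sum_distrib_left
      by (subst sum.swap) (simp add: mult_ac)
    then show ?thesis by (simp add: vanish)
  qed
  let ?p = "\<Prod>y\<in>S - {x}. [:- z y, 1:]"
  have "poly ?p (z y) = 0" if "y \<in> S - {x}" for y
    using that fin by (auto simp: poly_prod)
  then have "(\<Sum>y\<in>S. c y * poly ?p (z y)) = c x * poly ?p (z x)"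
    using fin \<open>x \<in> S\<close> by (simp add: sum.remove)
  moreover have "poly ?p (z x) \<noteq> 0"
    using fin inj \<open>x \<in> S\<close> by (auto simp: poly_prod inj_on_def)
  ultimately show ?thesis
    using poly [of ?p] by simp
qed

text \<open>Sampling at the multiples of a small step \<open>s\<close> turns distinct frequencies into distinct bases.\<close>
lemma exponentials_independent:
  fixes c :: "complex \<Rightarrow> complex"
  assumes fin: "finite S"
    and vanish: "\<And>t::real. t \<ge> 0 \<Longrightarrow> (\<Sum>\<theta>\<in>S. c \<theta> * exp (- \<i> * of_real t * \<theta>)) = 0"
    and "\<theta> \<in> S"
  shows "c \<theta> = 0"
proof -
  \<comment> \<open>This bounds every \<open>s * cmod \<eta>\<close> by \<open>1 < pi\<close>, so
    two exponents have imaginary parts less than \<open>2 * pi\<close> apart and \<open>exp\<close>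
    is injective on them. The summand \<open>1\<close> keeps the denominator positive.\<close>
  define s where "s = 1 / (1 + (\<Sum>\<theta>\<in>S. cmod \<theta>))"
  have pos: "1 + (\<Sum>\<theta>\<in>S. cmod \<theta>) > 0"
    by (simp add: add_pos_nonneg sum_nonneg)
  then have "s > 0" by (simp add: s_def)
  have bound: "\<bar>Im (- \<i> * of_real s * \<eta>)\<bar> < pi" if "\<eta> \<in> S" for \<eta>
  proof -
    have "\<bar>Im (- \<i> * of_real s * \<eta>)\<bar> \<le> cmod (- \<i> * of_real s * \<eta>)"
      by (rule abs_Im_le_cmod)
    also have "\<dots> = s * cmod \<eta>"
      using \<open>s > 0\<close> by (simp add: norm_mult)
    also have "\<dots> \<le> 1"
      using member_le_sum [of \<eta> S cmod] that fin pos by (simp add: s_def)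
    also have "\<dots> < pi" using pi_gt3 by simp
    finally show ?thesis .
  qed
  have "inj_on (\<lambda>\<eta>. exp (- \<i> * of_real s * \<eta>)) S"
  proof (rule inj_onI)
    fix x y assume S: "x \<in> S" "y \<in> S"
      and eq: "exp (- \<i> * of_real s * x) = exp (- \<i> * of_real s * y)"
    have "\<bar>Im (- \<i> * of_real s * x) - Im (- \<i> * of_real s * y)\<bar> < 2 * pi"
      using bound [OF S(1)] bound [OF S(2)] by linarith
    then have "- \<i> * of_real s * x = - \<i> * of_real s * y"
      using eq by (rule exp_complex_eqI)
    then show "x = y" using \<open>s > 0\<close> by simp
  qed
  moreover have "(\<Sum>\<eta>\<in>S. c \<eta> * exp (- \<i> * of_real s * \<eta>) ^ m) = 0" for m
    using vanish [of "real m * s"] \<open>s > 0\<close>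
    by (simp add: exp_of_nat_mult [symmetric] mult_ac)
  ultimately show ?thesis
    using geometric_sequences_independent [OF fin] \<open>\<theta> \<in> S\<close> by blast
qed

section \<open>Zero transfer as a condition on index sets\<close>

text \<open>Grouping the \<open>j\<close> by the value of \<open>mu n C j\<close> writes the entry
  as a combination of exponentials with distinct frequencies, so every coefficient must vanish.
  Other \<theta> have an empty index set.\<close>

lemma zero_transfer_iff:
  assumes "oriented_circulant n C" and uv: "u < n" "v < n"
  shows "zero_transfer n C u v \<longleftrightarrow>
    (\<forall>\<theta>. (\<Sum>j\<in>index_set n C \<theta>. omega n powi (int j * (int u - int v))) = 0)"
proof -
  let ?w = "\<lambda>j. omega n powi (int j * (int u - int v))"
  let ?S = "mu n C ` {..<n}" and ?c = "\<lambda>\<theta>. \<Sum>j\<in>index_set n C \<theta>. ?w j"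
  have idx: "{j \<in> {..<n}. mu n C j = \<theta>} = index_set n C \<theta>" for \<theta>
    by (auto simp: index_set_def)
  have "(\<Sum>\<theta>\<in>?S. ?c \<theta> * exp (- \<i> * of_real t * \<theta>)) =
      (\<Sum>j<n. exp (- \<i> * of_real t * mu n C j) * ?w j)" for t
  proof -
    have "(\<Sum>j<n. exp (- \<i> * of_real t * mu n C j) * ?w j) =
        (\<Sum>\<theta>\<in>?S. \<Sum>j | j \<in> {..<n} \<and> mu n C j = \<theta>. exp (- \<i> * of_real t * mu n C j) * ?w j)"
      by (rule sum.image_gen) simp
    also have "\<dots> = (\<Sum>\<theta>\<in>?S. ?c \<theta> * exp (- \<i> * of_real t * \<theta>))"
      unfolding idx sum_distrib_right
      by (intro sum.cong) (auto simp: index_set_def)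
    finally show ?thesis by simp
  qed
  then have entry: "transition_mat n C t $$ (u, v) =
      (\<Sum>\<theta>\<in>?S. ?c \<theta> * exp (- \<i> * of_real t * \<theta>)) / of_nat n" for t
    by (simp add: transition_mat_index [OF assms])
  show ?thesis
  proof
    assume "zero_transfer n C u v"
    then have "(\<Sum>\<theta>\<in>?S. ?c \<theta> * exp (- \<i> * of_real t * \<theta>)) = 0" if "t \<ge> 0" for t
      using that uv by (auto simp: zero_transfer_def entry)
    then have "?c \<theta> = 0" if "\<theta> \<in> ?S" for \<theta>
      using exponentials_independent [of ?S ?c \<theta>] that by blast
    moreover have "index_set n C \<theta> = {}" if "\<theta> \<notin> ?S" for \<theta>
      using that by (auto simp: index_set_def)
    ultimately show "\<forall>\<theta>. ?c \<theta> = 0"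
      by (metis sum.empty)
  next
    assume "\<forall>\<theta>. ?c \<theta> = 0"
    then show "zero_transfer n C u v"
      by (simp add: zero_transfer_def entry)
  qed
qed

section \<open>The quarter-turn case\<close>

lemma sum_i_powers_eq_0_iff:
  assumes fin: "finite M"
  shows "(\<Sum>j\<in>M. \<i> ^ j) = 0 \<longleftrightarrow>
    card (M \<inter> {j. j mod 4 = 0}) = card (M \<inter> {j. j mod 4 = 2}) \<and>
    card (M \<inter> {j. j mod 4 = 1}) = card (M \<inter> {j. j mod 4 = 3})"
proof -
  \<comment> \<open>The counts are taken as reals to avoid truncated subtraction.\<close>
  define N where "N r = real (card (M \<inter> {j. j mod 4 = r}))" for r
  have N: "N r = (\<Sum>j\<in>M. if j mod 4 = r then 1 else 0)" for r
    using fin by (simp add: N_def sum.If_cases Int_def)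
  have i: "\<i> ^ j = Complex ((if j mod 4 = 0 then 1 else 0) - (if j mod 4 = 2 then 1 else 0))
      ((if j mod 4 = 1 then 1 else 0) - (if j mod 4 = 3 then 1 else 0))" for j
  proof -
    have "\<i> ^ j = \<i> ^ (4 * (j div 4) + j mod 4)"
      by simp
    also have "\<dots> = \<i> ^ (j mod 4)"
      unfolding power_add power_mult by simp
    finally have "\<i> ^ j = \<i> ^ (j mod 4)" .
    moreover have "j mod 4 = 0 \<or> j mod 4 = 1 \<or> j mod 4 = 2 \<or> j mod 4 = 3"
      by linarith
    ultimately show ?thesis
      by (auto simp: complex_eq_iff power3_eq_cube power2_eq_square)
  qed
  have "Re (\<Sum>j\<in>M. \<i> ^ j) = N 0 - N 2" "Im (\<Sum>j\<in>M. \<i> ^ j) = N 1 - N 3"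
    by (simp_all only: i N Re_sum Im_sum complex.sel sum_subtractf)
  then show ?thesis
    by (auto simp: complex_eq_iff N_def)
qed

text \<open>Since \<open>4\<close> divides \<open>n\<close>, the power
  \<open>omega n ^ (n div 4)\<close> is exactly \<open>cis (pi / 2)\<close>.\<close>

lemma omega_powi_quarter:
  assumes "n > 0" "n mod 4 = 0"
  shows "omega n powi (int j * int (n div 4)) = \<i> ^ j"
proof -
  have "real n = 4 * real (n div 4)"
    using assms(2) by (metis mod_0_imp_dvd dvd_mult_div_cancel of_nat_mult of_nat_numeral)
  then have "omega n ^ (n div 4) = cis (pi / 2)"
    using assms(1) by (simp add: omega_power field_simps)
  then show ?thesis
    by (simp only: mult.commute [of "int j"] power_int_mult power_int_of_nat cis_pi_half)
qed

theorem theorem4p4: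
  fixes n :: nat and C :: "int set"
  assumes "n > 0"
    and "n mod 4 = 0"
    and "oriented_circulant n C"
    and "connected_circulant n C"
  shows "zero_transfer n C (n div 4) 0 \<longleftrightarrow>
    (\<forall>\<theta>::complex. eigenvalue (herm_adj n C) \<theta> \<longrightarrow>
       card (index_set n C \<theta> \<inter> {j. j mod 4 = 0}) = card (index_set n C \<theta> \<inter> {j. j mod 4 = 2}) \<and>
       card (index_set n C \<theta> \<inter> {j. j mod 4 = 1}) = card (index_set n C \<theta> \<inter> {j. j mod 4 = 3}))"
proof -
  have "zero_transfer n C (n div 4) 0 \<longleftrightarrow> (\<forall>\<theta>. (\<Sum>j\<in>index_set n C \<theta>. \<i> ^ j) = 0)"
    using zero_transfer_iff [OF assms(3), of "n div 4" 0] assms(1)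
    by (simp add: omega_powi_quarter [OF assms(1,2)])
  also have "\<dots> \<longleftrightarrow> (\<forall>\<theta>. eigenvalue (herm_adj n C) \<theta> \<longrightarrow> (\<Sum>j\<in>index_set n C \<theta>. \<i> ^ j) = 0)"
  proof -
    \<comment> \<open>Each \<open>j\<close> in the index set of \<theta> supplies an eigenvector for
      \<theta>, so restricting to eigenvalues drops only empty sums.\<close>
    have "index_set n C \<theta> = {}" if "\<not> eigenvalue (herm_adj n C) \<theta>" for \<theta>
      using that eigenvector_herm_adj [OF assms(1,3)]
      by (auto simp: index_set_def eigenvalue_def)
    then show ?thesis by (metis sum.empty)
  qed
  finally show ?thesis
    using sum_i_powers_eq_0_iff [of "index_set n C _"] by (simp add: index_set_def)
qed

end
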